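(* Let $\zeta$ be an admissible substitution of constant length $L$ on a two-letter alphabet $\mathcal{A}$, with recognizability index $K$, and let $\mathbf{u}=\alpha_1\alpha_2\ldots$ be a fixed point of $\zeta$. Then there exists a finite coloring of $\mathcal{L}(\mathbf{u})$ avoiding uniform monochromatic $k$-powers for all $k$ sufficiently large. That is, there exist $r\geq 1$, a map $c:\mathcal{L}(\mathbf{u})\to\{1,\ldots,r\}$ and an integer $k_1$ such that for every $k\geq k_1$ no word in $\mathcal{L}(\mathbf{u})$ is a uniform monochromatic $k$-power with respect to $c$.
   Context: Words. $\mathcal{A}$ is a finite alphabet, $\mathcal{A}^*$ is the monoid of finite words over $\mathcal{A}$ under concatenation (with the empty word as identity), and $|\mathbf{w}|$ is the length of $\mathbf{w}$. For an infinite word $\mathbf{u}=\alpha_1\alpha_2\alpha_3\ldots$ over $\mathcal{A}$, $\mathbf{u}_{[i,j]}=\alpha_i\alpha_{i+1}\ldots\alpha_j$ for $1\le i\le j$, $\mathbf{u}_{[1,0]}$ is the empty word, and $\mathcal{L}(\mathbf{u})$ is the set of all nonempty finite factors of $\mathbf{u}$. Powers. Given a coloring $c:\mathcal{L}(\mathbf{u})\to\{1,\ldots,r\}$, a word $\mathbf{w}\in\mathcal{L}(\mathbf{u})$ is a monochromatic $k$-power if there is a factorization $\mathbf{w}=\mathbf{w}_1\mathbf{w}_2\ldots\mathbf{w}_k$ with $\mathbf{w}_i\in\mathcal{L}(\mathbf{u})$ and $c(\mathbf{w}_i)=c(\mathbf{w}_j)$ for all $i,j$; it is uniform if moreover $|\mathbf{w}_i|=|\mathbf{w}_j|$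 for all $i,j$. Substitutions. A substitution $\zeta$ of $\mathcal{A}$ is a map $\zeta:\mathcal{A}\to\mathcal{A}^*$, extended to a morphism of $\mathcal{A}^*$ and to infinite words by concatenation. It has constant length $L$ if $|\zeta(\alpha)|=L$ for all $\alpha\in\mathcal{A}$. It is primitive if there is $n>0$ such that for all $\alpha,\beta\in\mathcal{A}$ the letter $\beta$ occurs in $\zeta^n(\alpha)$. Let $\mathcal{L}_\zeta$ be the set of all factors of the words $\zeta^n(\alpha)$, $n\ge 0$, $\alpha\in\mathcal{A}$, and $X_\zeta=\{\mathbf{v}\in\mathcal{A}^{\mathbb{N}}:\mathcal{L}(\mathbf{v})\subseteq\mathcal{L}_\zeta\}$. A fixed point of $\zeta$ is an infinite word $\mathbf{u}\in X_\zeta$ with $\zeta(\mathbf{u})=\mathbf{u}$. It is assumed throughout that some letter $\alpha$ is the first letter of $\zeta(\alpha)$. Recognizability (with respect to the fixed point $\mathbf{u}$). The $1$-cutting bars of $\zeta$ are the elements of $E_1=\{1\}\cup\{|\zeta(\mathbf{u}_{[1,p]})|+1: p\ge 1\}$. An integer interval $I=[i^-,i^+]$ with $1\le i^-\le i^+$ is $1$-fitted if $i^-$ and $i^++1$ are $1$-cutting bars; in this case $p_I,q_I\geq 0$ are defined by $i^-=|\zeta(\mathbf{u}_{[1,p_I]})|+1$ and $i^++1=|\zeta(\mathbf{u}_{[1,q_I]})|+1$, so that $\mathbf{u}_I=\zeta(\mathbf{u}_{[p_I+1,q_I]})$. The substitution $\zeta$ is strongly recognizable if there exists an integer $K\ge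 0$ such that: whenever $I$ is a $1$-fitted interval with $|I|>K$ (where $|I|$ is the number of integers in $I$) and $J$ is an integer interval with $\mathbf{u}_I=\mathbf{u}_J$, then $J$ is also $1$-fitted and $\mathbf{u}_{[p_I+1,q_I]}=\mathbf{u}_{[p_J+1,q_J]}$. The smallest such $K$ is the recognizability index of $\zeta$. The substitution $\zeta$ is admissible if it is primitive and strongly recognizable. *)

theory Defs
  imports "HOL-Library.Omega_Words_Fun" "HOL-Library.Sublist" "HOL-Library.FuncSet"
    "HOL-Library.Cardinality"
begin

text \<open>
  The alphabet is a type \<open>'a\<close>, finite words are lists, and an infinite word
  \<open>\<alpha>\<^sub>1\<alpha>\<^sub>2\<alpha>\<^sub>3\<dots>\<close> is a function \<open>u :: nat \<Rightarrow> 'a\<close> with \<open>\<alpha>\<^sub>i = u (i - 1)\<close>.  All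
  positions below (factors, cutting bars, intervals) are counted from 1.
\<close>

text \<open>\<open>factor u i j\<close> is \<open>u\<^bsub>[i,j]\<^esub> = \<alpha>\<^sub>i\<dots>\<alpha>\<^sub>j\<close>, to be used with \<open>i \<ge> 1\<close>; it is empty if \<open>j < i\<close>.\<close>

definition factor :: "'a word \<Rightarrow> nat \<Rightarrow> nat \<Rightarrow> 'a list" where
  "factor u i j = subsequence u (i - 1) j"

definition language :: "'a word \<Rightarrow> 'a list set" where
  "language u = {factor u i j | i j. 1 \<le> i \<and> i \<le> j}"

definition uniform_monochromatic_power ::
    "'a word \<Rightarrow> ('a list \<Rightarrow> nat) \<Rightarrow> nat \<Rightarrow> 'a list \<Rightarrow> bool" where
  "uniform_monochromatic_power u c k w \<longleftrightarrow>
     w \<in> language u \<and>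
     (\<exists>ws. length ws = k \<and> concat ws = w \<and> set ws \<subseteq> language u \<and>
           (\<forall>x\<in>set ws. \<forall>y\<in>set ws. c x = c y) \<and>
           (\<forall>x\<in>set ws. \<forall>y\<in>set ws. length x = length y))"

definition morph :: "('a \<Rightarrow> 'a list) \<Rightarrow> 'a list \<Rightarrow> 'a list" where
  "morph \<zeta> w = concat (map \<zeta> w)"

text \<open>
  \<open>infinite_image \<zeta> u v\<close> says that the concatenation \<open>\<zeta>(\<alpha>\<^sub>1)\<zeta>(\<alpha>\<^sub>2)\<dots>\<close> is infinite and
  equal to \<open>v\<close>.  A relation is used because this concatenation can be finite when
  some \<open>\<zeta>(\<alpha>)\<close> is empty.
\<close>

definition infinite_image :: "('a \<Rightarrow> 'a list) \<Rightarrow> 'a word \<Rightarrow> 'a word \<Rightarrow> bool" where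
  "infinite_image \<zeta> u v \<longleftrightarrow>
     (\<forall>n. morph \<zeta> (factor u 1 n) = factor v 1 (length (morph \<zeta> (factor u 1 n)))) \<and>
     (\<forall>m. \<exists>n. m \<le> length (morph \<zeta> (factor u 1 n)))"

definition constant_length :: "('a \<Rightarrow> 'a list) \<Rightarrow> nat \<Rightarrow> bool" where
  "constant_length \<zeta> L \<longleftrightarrow> (\<forall>\<alpha>. length (\<zeta> \<alpha>) = L)"

definition primitive :: "('a \<Rightarrow> 'a list) \<Rightarrow> bool" where
  "primitive \<zeta> \<longleftrightarrow> (\<exists>n>0. \<forall>\<alpha> \<beta>. \<beta> \<in> set ((morph \<zeta> ^^ n) [\<alpha>]))"

definition subst_language :: "('a \<Rightarrow> 'a list) \<Rightarrow> 'a list set" where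
  "subst_language \<zeta> = {w. \<exists>n \<alpha>. sublist w ((morph \<zeta> ^^ n) [\<alpha>])}"

definition subst_space :: "('a \<Rightarrow> 'a list) \<Rightarrow> 'a word set" where
  "subst_space \<zeta> = {v. language v \<subseteq> subst_language \<zeta>}"

definition fixed_point :: "('a \<Rightarrow> 'a list) \<Rightarrow> 'a word \<Rightarrow> bool" where
  "fixed_point \<zeta> u \<longleftrightarrow> u \<in> subst_space \<zeta> \<and> infinite_image \<zeta> u u"

text \<open>The cutting bar after \<open>\<zeta>(u\<^bsub>[1,p]\<^esub>)\<close>; it is 1 for \<open>p = 0\<close>.\<close>

definition cut :: "('a \<Rightarrow> 'a list) \<Rightarrow> 'a word \<Rightarrow> nat \<Rightarrow> nat" where
  "cut \<zeta> u p = length (morph \<zeta> (factor u 1 p)) + 1"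

definition cutting_bars :: "('a \<Rightarrow> 'a list) \<Rightarrow> 'a word \<Rightarrow> nat set" where
  "cutting_bars \<zeta> u = {1} \<union> {cut \<zeta> u p | p. p \<ge> 1}"

text \<open>Unique whenever \<open>b\<close> is a cutting bar and no \<open>\<zeta>(\<alpha>)\<close> is empty.\<close>

definition cut_index :: "('a \<Rightarrow> 'a list) \<Rightarrow> 'a word \<Rightarrow> nat \<Rightarrow> nat" where
  "cut_index \<zeta> u b = (THE p. b = cut \<zeta> u p)"

definition fitted :: "('a \<Rightarrow> 'a list) \<Rightarrow> 'a word \<Rightarrow> nat \<Rightarrow> nat \<Rightarrow> bool" where
  "fitted \<zeta> u i j \<longleftrightarrow> 1 \<le> i \<and> i \<le> j \<and> i \<in> cutting_bars \<zeta> u \<and> j + 1 \<in> cutting_bars \<zeta> u"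

text \<open>For a fitted interval \<open>I = [i,j]\<close> this is \<open>u\<^bsub>[p\<^sub>I+1,q\<^sub>I]\<^esub>\<close>, so that \<open>u\<^sub>I\<close> is its image under \<open>\<zeta>\<close>.\<close>

definition desubstitution :: "('a \<Rightarrow> 'a list) \<Rightarrow> 'a word \<Rightarrow> nat \<Rightarrow> nat \<Rightarrow> 'a list" where
  "desubstitution \<zeta> u i j = factor u (cut_index \<zeta> u i + 1) (cut_index \<zeta> u (j + 1))"

definition recognizes :: "('a \<Rightarrow> 'a list) \<Rightarrow> 'a word \<Rightarrow> nat \<Rightarrow> bool" where
  "recognizes \<zeta> u K \<longleftrightarrow>
     (\<forall>i j i' j'. fitted \<zeta> u i j \<and> card {i..j} > K \<and> 1 \<le> i' \<and> i' \<le> j' \<and>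
        factor u i j = factor u i' j' \<longrightarrow>
        fitted \<zeta> u i' j' \<and> desubstitution \<zeta> u i j = desubstitution \<zeta> u i' j')"

definition strongly_recognizable :: "('a \<Rightarrow> 'a list) \<Rightarrow> 'a word \<Rightarrow> bool" where
  "strongly_recognizable \<zeta> u \<longleftrightarrow> (\<exists>K. recognizes \<zeta> u K)"

definition recognizability_index :: "('a \<Rightarrow> 'a list) \<Rightarrow> 'a word \<Rightarrow> nat" where
  "recognizability_index \<zeta> u = (LEAST K. recognizes \<zeta> u K)"

definition admissible :: "('a \<Rightarrow> 'a list) \<Rightarrow> 'a word \<Rightarrow> bool" where
  "admissible \<zeta> u \<longleftrightarrow> primitive \<zeta> \<and> strongly_recognizable \<zeta> u"

end

theory Submission
  imports Defs "HOL-Number_Theory.Cong"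
begin

text \<open>
  By recognizability, two occurrences of a sufficiently long factor, of length at least a
  constant times \<open>L\<^sup>n\<close>, start at positions that are congruent modulo \<open>L\<^sup>n\<close>.  Since \<open>\<zeta>\<close> is
  injective on the two letters, there are offsets \<open>d\<^sub>n < L\<^sup>n\<close> such that the subsequence of
  \<open>u\<close> along the positions congruent to \<open>d\<^sub>n\<close> modulo \<open>L\<^sup>n\<close> is \<open>u\<close> itself up to a renaming
  of letters.  Colour a factor \<open>w\<close> by the letters which it shows at these positions, with
  \<open>n\<close> chosen such that \<open>\<bar>w\<bar>\<close> is comparable to \<open>L\<^sup>n\<close>; these are boundedly many letters.  A
  uniform monochromatic power then gives a power of the same exponent in \<open>u\<close> with a short
  base, of length \<open>q\<close> say.  But a long factor with period \<open>q\<close> occurs at two positions with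
  difference \<open>q\<close>, so \<open>L\<^sup>n\<close> divides \<open>q\<close> for large \<open>n\<close>, which is absurd.
\<close>

section \<open>Constant-length morphisms, cutting bars and desubstitution\<close>

lemma length_morph:
  assumes "constant_length \<zeta> L"
  shows "length (morph \<zeta> w) = length w * L"
  using assms by (induction w) (auto simp: morph_def constant_length_def)

lemma morph_append: "morph \<zeta> (v @ w) = morph \<zeta> v @ morph \<zeta> w"
  by (simp add: morph_def)

lemma factor_eq_iff:
  assumes "i \<ge> 1" "i' \<ge> 1"
  shows "factor u i (i + m - 1) = factor u i' (i' + m - 1) \<longleftrightarrow>
    (\<forall>t<m. u (i - 1 + t) = u (i' - 1 + t))"
  using assms by (auto simp: factor_def list_eq_iff_nth_eq)

lemma cut_eq:
  assumes "constant_length \<zeta> L"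
  shows "cut \<zeta> u p = p * L + 1"
  by (simp add: cut_def length_morph[OF assms] factor_def)

lemma cut_index_eq:
  assumes "constant_length \<zeta> L" "L > 0"
  shows "cut_index \<zeta> u (p * L + 1) = p"
  using assms(2) by (auto simp: cut_index_def cut_eq[OF assms(1)])

lemma mem_cutting_bars_iff:
  assumes "constant_length \<zeta> L"
  shows "b + 1 \<in> cutting_bars \<zeta> u \<longleftrightarrow> L dvd b"
proof
  assume "L dvd b"
  then obtain p where "b = p * L" by (metis dvd_def mult.commute)
  then show "b + 1 \<in> cutting_bars \<zeta> u"
    by (cases "p = 0") (auto simp: cutting_bars_def cut_eq[OF assms])
qed (auto simp: cutting_bars_def cut_eq[OF assms])

text \<open>The images of the prefixes of \<open>u\<close> with \<open>i\<close> and
  \<open>i + 1\<close> letters differ exactly by the block \<open>\<zeta> (u i)\<close>.\<close>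

lemma infinite_image_nth:
  assumes "infinite_image \<zeta> u u" "constant_length \<zeta> L" "j < L"
  shows "u (i * L + j) = \<zeta> (u i) ! j"
proof -
  have len: "length (\<zeta> x) = L" for x
    using assms(2) by (simp add: constant_length_def)
  have "morph \<zeta> (factor u 1 n) = factor u 1 (length (morph \<zeta> (factor u 1 n)))" for n
    using assms(1) by (simp add: infinite_image_def)
  then have eq: "morph \<zeta> (map u [0..<n]) = map u [0..<n * L]" for n
    by (simp add: factor_def length_morph[OF assms(2)] subsequence_def)
  have lt: "i * L + j < Suc i * L"
    using assms(3) by simp
  have "u (i * L + j) = map u [0..<Suc i * L] ! (i * L + j)"
    using nth_map_upt[of "i * L + j" "Suc i * L" 0 u] lt by simp
  also have "\<dots> = (map u [0..<i * L] @ \<zeta> (u i)) ! (i * L + j)"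
    unfolding eq[symmetric] by (simp add: morph_append) (simp add: morph_def)
  finally show ?thesis
    by (simp add: nth_append)
qed

text \<open>For \<open>L = 1\<close> the letter \<alpha> would be its own image, so \<beta> could
  never occur in an iterate of \<alpha>.\<close>

lemma primitive_length_ge_2:
  assumes "primitive \<zeta>" "constant_length \<zeta> L" "\<zeta> \<alpha> = \<alpha> # w" "\<beta> \<noteq> \<alpha>"
  shows "L \<ge> 2"
proof (rule ccontr)
  assume "\<not> L \<ge> 2"
  moreover have "length (\<zeta> \<alpha>) = L"
    using assms(2) by (simp add: constant_length_def)
  ultimately have "morph \<zeta> [\<alpha>] = [\<alpha>]"
    using assms(3) by (cases w) (auto simp: morph_def)
  then have "(morph \<zeta> ^^ n) [\<alpha>] = [\<alpha>]" for n
    by (induction n) simp_all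
  moreover obtain n where "\<beta> \<in> set ((morph \<zeta> ^^ n) [\<alpha>])"
    using assms(1) by (auto simp: primitive_def)
  ultimately show False
    using assms(4) by simp
qed

text \<open>Recognizability in 0-based positions: the cutting bars become the multiples of
  \<open>L\<close>, and the desubstituted words are compared letter by letter.\<close>

lemma recognizes_constant_length:
  assumes rec: "recognizes \<zeta> u K" and cl: "constant_length \<zeta> L" and "L > 0"
    and m: "m * L > K" and eq: "\<And>t. t < m * L \<Longrightarrow> u (p * L + t) = u (a + t)"
  shows "\<exists>p'. a = p' * L \<and> (\<forall>t<m. u (p + t) = u (p' + t))"
proof -
  define i j i' j' where
    "i = p * L + 1" and "j = p * L + m * L" and "i' = a + 1" and "j' = a + m * L"
  have pos: "m * L > 0"
    using m by linarith
  have "fitted \<zeta> u i j"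
    using pos mem_cutting_bars_iff[OF cl, of "p * L" u]
      mem_cutting_bars_iff[OF cl, of "p * L + m * L" u]
    by (simp add: fitted_def i_def j_def)
  moreover have "factor u i j = factor u i' j'"
    using factor_eq_iff[of i i' u "m * L"] eq by (simp add: i_def j_def i'_def j'_def)
  moreover have "card {i..j} > K"
    using m by (simp add: i_def j_def)
  moreover have "1 \<le> i'" "i' \<le> j'"
    using pos by (simp_all add: i'_def j'_def)
  ultimately have fit: "fitted \<zeta> u i' j'"
    and des: "desubstitution \<zeta> u i j = desubstitution \<zeta> u i' j'"
    using rec unfolding recognizes_def by blast+
  from fit have "L dvd a"
    using mem_cutting_bars_iff[OF cl, of a u] by (simp add: fitted_def i'_def)
  then obtain p' where p': "a = p' * L"
    by (metis dvd_def mult.commute)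
  have "desubstitution \<zeta> u (x * L + 1) (x * L + m * L) = map u [x..<x + m]" for x
    using cut_index_eq[OF cl \<open>L > 0\<close>, of u x] cut_index_eq[OF cl \<open>L > 0\<close>, of u "x + m"]
    by (simp add: desubstitution_def factor_def subsequence_def add_mult_distrib)
  from des[unfolded i_def j_def i'_def j'_def p' this] p' show ?thesis
    by (auto simp: list_eq_iff_nth_eq)
qed

section \<open>Positions of repeated factors, periods and separating offsets\<close>

locale recognizable_fixed_point =
  fixes \<zeta> :: "'a::finite \<Rightarrow> 'a list" and u :: "nat \<Rightarrow> 'a" and L K :: nat
  assumes L_ge_2: "L \<ge> 2"
    and card_alphabet: "CARD('a) = 2"
    and fixed_point_nth: "j < L \<Longrightarrow> u (i * L + j) = \<zeta> (u i) ! j"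
    and length_image: "length (\<zeta> x) = L"
    and desubstitute: "m * L > K \<Longrightarrow> (\<And>t. t < m * L \<Longrightarrow> u (p * L + t) = u (a + t)) \<Longrightarrow>
      \<exists>p'. a = p' * L \<and> (\<forall>t<m. u (p + t) = u (p' + t))"
begin

text \<open>The summand 4 absorbs the fewer than \<open>2L\<close> letters lost in each desubstitution.\<close>

lemma occurrences_cong:
  assumes "(K + 4) * L ^ n \<le> l + 4" "\<And>t. t < l \<Longrightarrow> u (a + t) = u (a' + t)"
  shows "[a = a'] (mod L ^ n)"
  using assms
proof (induction n arbitrary: l a a')
  case 0
  then show ?case by simp
next
  case (Suc n)
  \<comment> \<open>\<open>p * L\<close> is the first cutting position at or after \<open>a\<close>,
    and \<open>s\<close> is the distance to it; \<open>m\<close> below counts the complete blocks in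
    the remaining \<open>l - s\<close> letters.\<close>
  define p where "p = (a + (L - 1)) div L"
  define s where "s = p * L - a"
  have mod_less: "x mod L < L" for x
    using L_ge_2 by simp
  have "p * L + (a + (L - 1)) mod L = a + (L - 1)"
    unfolding p_def by (rule div_mult_mod_eq)
  with mod_less[of "a + (L - 1)"] have as: "a + s = p * L" and s: "s < L"
    unfolding s_def by linarith+
  define m where "m = (l - s) div L"
  have "m * L + (l - s) mod L = l - s"
    unfolding m_def by (rule div_mult_mod_eq)
  with mod_less[of "l - s"] s have ml: "m * L \<le> l - s" "l + 2 \<le> m * L + 2 * L"
    by linarith+
  have len: "((K + 4) * L ^ n) * L \<le> l + 4"
    using Suc.prems(1) by (simp add: algebra_simps)
  have "(K + 4) * 1 * L \<le> ((K + 4) * L ^ n) * L"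
    using L_ge_2 by (intro mult_right_mono mult_left_mono) auto
  with len have "K * L + 4 * L \<le> l + 4"
    by (simp add: add_mult_distrib)
  moreover have "K \<le> K * L"
    using L_ge_2 by simp
  ultimately have mK: "m * L > K"
    using ml(2) L_ge_2 by linarith
  have "\<exists>p'. a' + s = p' * L \<and> (\<forall>t<m. u (p + t) = u (p' + t))"
  proof (rule desubstitute[OF mK])
    fix t assume "t < m * L"
    then show "u (p * L + t) = u (a' + s + t)"
      using Suc.prems(2)[of "s + t"] ml(1) as by (simp add: add.assoc[symmetric])
  qed
  then obtain p' where p': "a' + s = p' * L" "\<And>t. t < m \<Longrightarrow> u (p + t) = u (p' + t)"
    by blast
  have "((K + 4) * L ^ n) * L \<le> (m + 4) * L"
    using len ml(2) L_ge_2 unfolding add_mult_distrib[of m] by linarith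
  then have "(K + 4) * L ^ n \<le> m + 4"
    using L_ge_2 by simp
  \<comment> \<open>The induction hypothesis gives \<open>p\<close> and \<open>p'\<close> congruent
    modulo \<open>L ^ n\<close>. Multiplying by \<open>L\<close> raises the modulus to
    \<open>L ^ Suc n\<close>; the common shift \<open>s\<close> then cancels.\<close>
  from Suc.IH[OF this p'(2)] have "[p * L = p' * L] (mod (L ^ n * L))"
    by (simp add: cong_def mult_mod_left)
  then have "[a + s = a' + s] (mod (L ^ Suc n))"
    by (simp add: as p'(1) mult.commute)
  then show ?case
    using cong_add_rcancel_nat by blast
qed

text \<open>A run of period \<open>q\<close> is a factor occurring at distance \<open>q\<close>. The
  level \<open>q\<close> itself is high enough for a contradiction: a long run would make
  \<open>L ^ q\<close> divide \<open>q\<close>, but \<open>0 < q < L ^ q\<close>.\<close>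

lemma periodic_run_bound:
  assumes "q > 0" "\<And>t. t < m \<Longrightarrow> u (b + t) = u (b + q + t)"
  shows "m < (K + 4) * L ^ q"
proof (rule ccontr)
  assume "\<not> m < (K + 4) * L ^ q"
  then have "[b = b + q] (mod L ^ q)"
    using assms by (intro occurrences_cong[of q m]) auto
  then have "[b + q = b + 0] (mod L ^ q)"
    by (simp add: cong_sym)
  then have "L ^ q dvd q"
    by (simp only: cong_add_lcancel_nat cong_0_iff)
  moreover have "q < L ^ q"
    using L_ge_2 by (intro power_gt_expt) simp
  ultimately show False
    using assms(1) by (simp add: nat_dvd_not_less)
qed

text \<open>With only two letters, a failure of injectivity makes \<zeta> constant; then
  \<open>u\<close> has period \<open>L\<close> throughout, contrary to
  \<open>periodic_run_bound\<close>.\<close>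

lemma inj_image: "inj \<zeta>"
proof (rule ccontr)
  assume "\<not> inj \<zeta>"
  then obtain x y where xy: "x \<noteq> y" "\<zeta> x = \<zeta> y"
    by (auto simp: inj_def)
  have "UNIV = {x, y}"
    using xy(1) card_alphabet by (intro card_seteq[symmetric]) auto
  then have const: "\<zeta> z = \<zeta> x" for z
    using xy(2) by (metis UNIV_I empty_iff insert_iff)
  have "u t = \<zeta> x ! (t mod L)" for t
    using fixed_point_nth[of "t mod L" "t div L"] L_ge_2 const[of "u (t div L)"] by simp
  then have "u (0 + t) = u (0 + L + t)" for t
    by simp
  from periodic_run_bound[OF _ this, of "(K + 4) * L ^ L"] L_ge_2 show False
    by simp
qed

text \<open>The images of the two letters differ in some column \<open>e\<close>, so reading column
  \<open>e\<close> is an injective renaming. Each further level refines the offset \<open>d\<close>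
  to \<open>d * L + e\<close> and composes the renamings.\<close>

lemma separating_offset: "\<exists>d f. d < L ^ n \<and> inj f \<and> (\<forall>i. u (i * L ^ n + d) = f (u i))"
proof (induction n)
  case 0
  show ?case by (intro exI[of _ 0] exI[of _ id]) simp
next
  case (Suc n)
  then obtain d f where df: "d < L ^ n" "inj f" "\<And>i. u (i * L ^ n + d) = f (u i)"
    by blast
  obtain x y :: 'a where xy: "x \<noteq> y" "UNIV = {x, y}"
    using card_alphabet by (metis card_2_iff)
  then have "\<zeta> x \<noteq> \<zeta> y"
    using inj_image by (auto dest: injD)
  then obtain e where e: "e < L" "\<zeta> x ! e \<noteq> \<zeta> y ! e"
    using length_image by (auto simp: list_eq_iff_nth_eq)
  define g where "g z = \<zeta> z ! e" for z
  have "inj g"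
    unfolding inj_def g_def using e(2) xy(2) by (metis UNIV_I empty_iff insert_iff)
  then have "inj (g \<circ> f)"
    using df(2) by (rule inj_compose)
  moreover have "u (i * L ^ Suc n + (d * L + e)) = (g \<circ> f) (u i)" for i
  proof -
    have "i * L ^ Suc n + (d * L + e) = (i * L ^ n + d) * L + e"
      by (simp add: algebra_simps)
    then show ?thesis
      using fixed_point_nth[OF e(1), of "i * L ^ n + d"] by (simp only: df(3) g_def comp_apply)
  qed
  moreover have "(d + 1) * L \<le> L ^ n * L"
    using df(1) by (intro mult_right_mono) auto
  then have "d * L + e < L ^ Suc n"
    using e(1) by (simp add: algebra_simps)
  ultimately show ?case
    by blast
qed

text \<open>Take the least \<open>n\<close> satisfying the last bound; its failure at
  \<open>n - 1\<close> is the first one. The first bound serves \<open>occurrences_cong\<close>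
  (level 0 being trivial), the other two keep the samples nonempty and boundedly long.\<close>

lemma ex_level:
  assumes "l > 0"
  shows "\<exists>n. (n = 0 \<or> (K + 4) * L ^ n \<le> l) \<and> L ^ n \<le> l \<and> l < (K + 4) * L * L ^ n"
proof -
  have "l < L ^ l"
    using L_ge_2 by (intro power_gt_expt) simp
  also have "L ^ l \<le> (K + 4) * L * L ^ l"
    using L_ge_2 by (simp del: mult.assoc)
  finally have ex: "\<exists>n. l < (K + 4) * L * L ^ n"
    by blast
  define n where "n = (LEAST n. l < (K + 4) * L * L ^ n)"
  have less: "l < (K + 4) * L * L ^ n"
    unfolding n_def using ex by (rule LeastI_ex)
  have "n = 0 \<or> (K + 4) * L ^ n \<le> l"
  proof (cases n)
    case (Suc k)
    then have "\<not> l < (K + 4) * L * L ^ k"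
      using not_less_Least[of k "\<lambda>n. l < (K + 4) * L * L ^ n"] unfolding n_def by simp
    with Suc show ?thesis by (simp add: algebra_simps)
  qed simp
  moreover have "L ^ n \<le> l"
  proof (cases "n = 0")
    case False
    have "L ^ n \<le> (K + 4) * L ^ n"
      by simp
    with calculation False show ?thesis
      by linarith
  qed (use assms in simp)
  ultimately show ?thesis
    using less by blast
qed

end

section \<open>Sampling a factor along an arithmetic progression\<close>

text \<open>\<open>progression_index M d a\<close> is the least \<open>i\<close> with \<open>a \<le> i * M + d\<close>, provided that \<open>d < M\<close>.\<close>

definition progression_index :: "nat \<Rightarrow> nat \<Rightarrow> nat \<Rightarrow> nat" where
  "progression_index M d a = (a + (M - 1 - d)) div M"

lemma progression_index_le_iff:
  assumes "d < M"
  shows "progression_index M d a \<le> i \<longleftrightarrow> a \<le> i * M + d"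
proof -
  have "progression_index M d a \<le> i \<longleftrightarrow> a + (M - 1 - d) < Suc i * M"
    using assms unfolding progression_index_def less_Suc_eq_le[symmetric]
    by (intro div_less_iff_less_mult) simp
  then show ?thesis
    using assms by auto
qed

lemma progression_index_add:
  assumes "M > 0"
  shows "progression_index M d (a + z * M) = progression_index M d a + z"
  using assms div_mult_self1[of M "a + (M - 1 - d)" z] by (simp add: progression_index_def add_ac)

lemma progression_index_mono: "a \<le> b \<Longrightarrow> progression_index M d a \<le> progression_index M d b"
  unfolding progression_index_def by (intro div_le_mono) simp

text \<open>The indices are those \<open>i\<close> with \<open>a \<le> i * M + d < a + l\<close>
  when \<open>d < M\<close>, so adjacent windows yield adjacent stretches of the sampled
  sequence.\<close>

definition progression_letters :: "'a word \<Rightarrow> nat \<Rightarrow> nat \<Rightarrow> nat \<Rightarrow> nat \<Rightarrow> 'a list" where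
  "progression_letters u M d a l =
     map (\<lambda>i. u (i * M + d)) [progression_index M d a..<progression_index M d (a + l)]"

lemma progression_letters_shift:
  assumes "d < M" "\<And>t. t < l \<Longrightarrow> u (a + t) = u (a + z * M + t)"
  shows "progression_letters u M d (a + z * M) l = progression_letters u M d a l"
proof -
  have "M > 0"
    using assms(1) by simp
  then have "progression_index M d (a + z * M) = progression_index M d a + z"
    "progression_index M d (a + z * M + l) = progression_index M d (a + l) + z"
    using progression_index_add[of M d a z] progression_index_add[of M d "a + l" z]
    by (simp_all add: add_ac)
  then have "progression_letters u M d (a + z * M) l =
      map (\<lambda>i. u ((i + z) * M + d)) [progression_index M d a..<progression_index M d (a + l)]"
    unfolding progression_letters_def by (intro nth_equalityI) (simp_all add: add_ac)
  also have "\<dots> = progression_letters u M d a l"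
    unfolding progression_letters_def
  proof (intro map_cong refl)
    fix i assume "i \<in> set [progression_index M d a..<progression_index M d (a + l)]"
    then have i: "a \<le> i * M + d" "i * M + d < a + l"
      using progression_index_le_iff[OF assms(1), of _ i] by (auto simp flip: not_le)
    then show "u ((i + z) * M + d) = u (i * M + d)"
      using assms(2)[of "i * M + d - a"] by (simp add: add_mult_distrib add_ac)
  qed
  finally show ?thesis .
qed

text \<open>This makes the color of a word independent of the occurrence at which it is sampled. By
  symmetry the second occurrence is a shift of the first by a multiple of \<open>M\<close>.\<close>

lemma progression_letters_cong:
  assumes "d < M" "\<And>t. t < l \<Longrightarrow> u (a + t) = u (a' + t)" "[a = a'] (mod M)"
  shows "progression_letters u M d a l = progression_letters u M d a' l"
proof -
  have *: "progression_letters u M d x l = progression_letters u M d y l"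
    if "x \<le> y" "\<And>t. t < l \<Longrightarrow> u (x + t) = u (y + t)" "[x = y] (mod M)" for x y
  proof -
    have "M dvd y - x"
      using cong_altdef_nat[OF that(1)] cong_sym[OF that(3)] by blast
    then obtain z where "y - x = M * z"
      by (rule dvdE)
    then have "y = x + z * M"
      using that(1) by (simp add: mult.commute)
    with progression_letters_shift[OF assms(1), of l u x z] that(2) show ?thesis
      by simp
  qed
  show ?thesis
  proof (cases "a \<le> a'")
    case True
    then show ?thesis
      using assms(2,3) by (rule *)
  next
    case False
    then have "a' \<le> a"
      by simp
    then show ?thesis
      using assms(2)[symmetric] cong_sym[OF assms(3)] by (rule *[symmetric])
  qed
qed

lemma length_progression_letters_le:
  assumes "M > 0" "l \<le> B * M"
  shows "length (progression_letters u M d a l) \<le> B"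
  using progression_index_mono[of "a + l" "a + B * M" M d] progression_index_add[OF assms(1), of d a B]
    assms(2) by (simp add: progression_letters_def)

lemma length_progression_letters_pos:
  assumes "M > 0" "M \<le> l"
  shows "length (progression_letters u M d a l) > 0"
  using progression_index_mono[of "a + 1 * M" "a + l" M d] progression_index_add[OF assms(1), of d a 1]
    assms(2) by (simp add: progression_letters_def)

text \<open>Each of the \<open>k\<close> windows advances the index by exactly \<open>q\<close>, so
  the sampled sequence shows \<open>y\<close> repeated \<open>k\<close> times and hence has period
  \<open>q\<close> there.\<close>

lemma progression_letters_power:
  assumes "q > 0" "length y = q"
    and "\<And>i. i < k \<Longrightarrow> progression_letters u M d (a + i * l) l = y"
    and "t + q < k * q"
  shows "u ((progression_index M d a + t) * M + d) = u ((progression_index M d a + q + t) * M + d)"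
proof -
  define b where "b = progression_index M d"
  have step: "b (a + Suc i * l) = b (a + i * l) + q" if "i < k" for i
    using assms(1) arg_cong[OF assms(3)[OF that], of length] assms(2)
    by (simp add: progression_letters_def b_def add_ac)
  have b: "b (a + i * l) = b a + i * q" if "i \<le> k" for i
    using that
  proof (induction i)
    case (Suc i)
    then show ?case
      using step[of i] by simp
  qed simp
  have letters: "u ((b a + (i * q + j)) * M + d) = y ! j" if "i < k" "j < q" for i j
    using arg_cong[OF assms(3)[OF that(1)], of "\<lambda>x. x ! j"] b[of i] step[OF that(1)] that
    by (simp add: progression_letters_def b_def[symmetric] add_ac)
  \<comment> \<open>\<open>t\<close> and \<open>t + q\<close> fall on the same place
    \<open>t mod q\<close> of two consecutive copies of \<open>y\<close>, both among the first
    \<open>k\<close>.\<close>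
  have "t div q + 1 = (t + q) div q"
    using assms(1) div_add_self2[of q t] by simp
  also have "\<dots> < k"
    using assms(4) by (simp add: less_mult_imp_div_less)
  finally have "t div q + 1 < k" .
  with letters[of "t div q" "t mod q"] letters[of "t div q + 1" "t mod q"] assms(1)
  show ?thesis
    by (simp add: b_def[symmetric] add_ac)
qed

section \<open>The coloring and the exclusion of uniform powers\<close>

lemma nth_concat_uniform:
  assumes "\<And>x. x \<in> set ws \<Longrightarrow> length x = l" "i < length ws" "t < l"
  shows "concat ws ! (i * l + t) = ws ! i ! t"
  using assms
proof (induction ws arbitrary: i)
  case (Cons x ws)
  then show ?case
    by (cases i) (auto simp: nth_append)
qed simp

context recognizable_fixed_point
begin

lemma ex_colouring:
  "\<exists>r\<ge>1. \<exists>c. c \<in> language u \<rightarrow> {1..r} \<and>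
    (\<exists>k1. \<forall>k\<ge>k1. \<forall>w\<in>language u. \<not> uniform_monochromatic_power u c k w)"
proof -
  define occ where "occ w a \<longleftrightarrow> (\<forall>t<length w. w ! t = u (a + t))" for w :: "'a list" and a
  have occ_ex: "\<exists>a. occ w a" and nonempty: "length w > 0" if w: "w \<in> language u" for w
  proof -
    obtain i j where "w = factor u i j" "1 \<le> i" "i \<le> j"
      using w unfolding language_def by blast
    then have "occ w (i - 1)" "length w > 0"
      by (auto simp: factor_def occ_def)
    then show "\<exists>a. occ w a" "length w > 0"
      by auto
  qed
  have "\<exists>n. \<forall>l. l > 0 \<longrightarrow> (n l = 0 \<or> (K + 4) * L ^ n l \<le> l) \<and>
      L ^ n l \<le> l \<and> l < (K + 4) * L * L ^ n l"
    using ex_level by (intro choice) simp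
  then obtain n where n: "\<And>l. l > 0 \<Longrightarrow> (n l = 0 \<or> (K + 4) * L ^ n l \<le> l) \<and>
      L ^ n l \<le> l \<and> l < (K + 4) * L * L ^ n l"
    by blast
  have "\<exists>d. \<forall>n. \<exists>f. d n < L ^ n \<and> inj f \<and> (\<forall>i. u (i * L ^ n + d n) = f (u i))"
    by (intro choice allI separating_offset)
  then obtain d where
    "\<forall>n. \<exists>f. d n < L ^ n \<and> inj f \<and> (\<forall>i. u (i * L ^ n + d n) = f (u i))" ..
  from choice[OF this] obtain f where df: "\<And>n. d n < L ^ n" "\<And>n. inj (f n)"
    "\<And>n i. u (i * L ^ n + d n) = f n (u i)"
    by blast
  define y where "y a l = progression_letters u (L ^ n l) (d (n l)) a l" for a l
  \<comment> \<open>An arbitrary occurrence is sampled; \<open>h_eq\<close> shows that every other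
    one gives the same letters.\<close>
  define h where "h w = y (SOME a. occ w a) (length w)" for w
  have h_eq: "h w = y a (length w)" if "occ w a" "length w > 0" for w a
  proof -
    define a' where "a' = (SOME a. occ w a)"
    have "occ w a'"
      unfolding a'_def using that(1) by (rule someI)
    then have eq: "u (a' + t) = u (a + t)" if "t < length w" for t
      using \<open>occ w a\<close> that unfolding occ_def by metis
    have "[a' = a] (mod L ^ n (length w))"
    proof (cases "n (length w) = 0")
      case False
      then have "(K + 4) * L ^ n (length w) \<le> length w + 4"
        using n[OF that(2)] by linarith
      then show ?thesis
        using eq by (rule occurrences_cong)
    qed simp
    then show ?thesis
      unfolding h_def y_def a'_def[symmetric] by (intro progression_letters_cong df(1) eq)
  qed
  \<comment> \<open>Since \<open>l < B * L ^ n l\<close> for all \<open>l > 0\<close>, samples have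
    at most \<open>B\<close> letters, so finitely many colors suffice.\<close>
  define B where "B = (K + 4) * L"
  have L_pow: "L ^ m > 0" for m
    using L_ge_2 by simp
  have y_length: "0 < length (y a l)" "length (y a l) \<le> B" if "l > 0" for a l
    using length_progression_letters_pos[OF L_pow, of "n l" l]
      length_progression_letters_le[OF L_pow, of l B "n l"] n[OF that]
    unfolding y_def B_def by (simp_all add: less_imp_le)
  have "finite {xs :: 'a list. length xs \<le> B}"
    using finite_lists_length_le[of "UNIV :: 'a set" B] by simp
  then obtain g :: "'a list \<Rightarrow> nat" and r where g: "g ` {xs. length xs \<le> B} = {i. i < r}"
    "inj_on g {xs. length xs \<le> B}"
    using finite_imp_inj_to_nat_seg by metis
  define c where "c w = g (h w) + 1" for w
  have h_bound: "length (h w) \<le> B" if "w \<in> language u" for w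
    using y_length nonempty[OF that] by (simp add: h_def)
  have "c w \<in> {1..r + 1}" if "w \<in> language u" for w
  proof -
    have "g (h w) \<in> {i. i < r}"
      unfolding g(1)[symmetric] using h_bound[OF that] by blast
    then show ?thesis
      by (simp add: c_def)
  qed
  then have c: "c \<in> language u \<rightarrow> {1..r + 1}"
    by (rule Pi_I)
  \<comment> \<open>The threshold makes \<open>k - 1\<close> at least the bound of
    \<open>periodic_run_bound\<close> for every period \<open>q \<le> B\<close>.\<close>
  have "\<not> uniform_monochromatic_power u c k w"
    if k: "k \<ge> (K + 4) * L ^ B + 1" and w: "w \<in> language u" for k w
  proof
    assume "uniform_monochromatic_power u c k w"
    then obtain ws where ws: "length ws = k" "concat ws = w" "set ws \<subseteq> language u"
      "\<And>x y. x \<in> set ws \<Longrightarrow> y \<in> set ws \<Longrightarrow> c x = c y"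
      "\<And>x y. x \<in> set ws \<Longrightarrow> y \<in> set ws \<Longrightarrow> length x = length y"
      unfolding uniform_monochromatic_power_def by blast
    have k0: "k > 0"
      using k by simp
    define l where "l = length (ws ! 0)"
    have mem: "ws ! i \<in> set ws" if "i < k" for i
      using that ws(1) by simp
    have l: "length x = l" if "x \<in> set ws" for x
      using ws(5)[OF that mem[OF k0]] by (simp add: l_def)
    have "l > 0"
      using nonempty mem[OF k0] ws(3) by (auto simp: l_def)
    obtain a where a: "occ w a"
      using occ_ex[OF w] by blast
    have "sum_list (map length ws) = sum_list (map (\<lambda>_. l) ws)"
      using l by (intro arg_cong[where f = sum_list] map_cong) auto
    then have len_w: "length w = k * l"
      using ws(1,2) by (auto simp: length_concat sum_list_triv)
    have occ_i: "occ (ws ! i) (a + i * l)" if "i < k" for i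
      unfolding occ_def
    proof (intro allI impI)
      fix t assume "t < length (ws ! i)"
      then have t: "t < l"
        using l[OF mem[OF that]] by simp
      have "Suc i * l \<le> k * l"
        using that by (intro mult_right_mono) auto
      then have "i * l + t < length w"
        using t len_w by simp
      then show "ws ! i ! t = u (a + i * l + t)"
        using a nth_concat_uniform[OF l _ t, of ws i] that ws(1,2)
        by (simp add: occ_def add_ac)
    qed
    have h_y: "h (ws ! i) = y (a + i * l) l" if "i < k" for i
      using h_eq[OF occ_i[OF that]] l[OF mem[OF that]] \<open>l > 0\<close> by simp
    define z where "z = y a l"
    have y_z: "y (a + i * l) l = z" if "i < k" for i
    proof -
      \<comment> \<open>Equal colors mean equal samples, as \<open>g\<close> is injective on lists
        of length at most \<open>B\<close>.\<close>
      have "h (ws ! i) = h (ws ! 0)"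
        using ws(4)[OF mem[OF that] mem[OF k0]] g(2) h_bound ws(3) mem[OF that] mem[OF k0]
        by (auto simp: c_def dest: inj_onD)
      then show ?thesis
        using h_y[OF that] h_y[OF k0] by (simp add: z_def)
    qed
    define q where "q = length z"
    have q: "q > 0" "q \<le> B"
      using y_length[OF \<open>l > 0\<close>] by (simp_all add: q_def z_def)
    define b where "b = progression_index (L ^ n l) (d (n l)) a"
    \<comment> \<open>The sampled sequence is \<open>u\<close> renamed by the injective
      \<open>f (n l)\<close>, so its period \<open>q\<close> passes to \<open>u\<close> itself, on a
      run of length \<open>(k - 1) * q\<close>.\<close>
    have "u (b + t) = u (b + q + t)" if "t < (k - 1) * q" for t
    proof -
      have "t + q < k * q"
        using that k0 by (simp add: diff_mult_distrib)
      then have "u ((b + t) * L ^ n l + d (n l)) = u ((b + q + t) * L ^ n l + d (n l))"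
        using progression_letters_power[OF q(1) q_def[symmetric], of k] y_z
        unfolding b_def y_def by blast
      then show ?thesis
        using df(2)[of "n l"] by (simp add: df(3) inj_eq)
    qed
    from periodic_run_bound[OF q(1) this] have "(k - 1) * q < (K + 4) * L ^ q" .
    also have "\<dots> \<le> (K + 4) * L ^ B"
      using q(2) L_ge_2 by (intro mult_left_mono power_increasing) auto
    also have "\<dots> \<le> (k - 1) * 1"
      using k by simp
    also have "\<dots> \<le> (k - 1) * q"
      using q(1) by (intro mult_left_mono) auto
    finally show False
      by simp
  qed
  with c show ?thesis
    by (intro exI[of _ "r + 1"] conjI exI[of _ c] exI[of _ "(K + 4) * L ^ B + 1"]) auto
qed

end

theorem theorem1:
  fixes \<zeta> :: "'a::finite \<Rightarrow> 'a list" and u :: "'a word" and L K :: nat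
  assumes "CARD('a) = 2"
    and "\<exists>\<alpha> w. \<zeta> \<alpha> = \<alpha> # w"
    and "constant_length \<zeta> L"
    and "fixed_point \<zeta> u"
    and "admissible \<zeta> u"
    and "K = recognizability_index \<zeta> u"
  shows "\<exists>r\<ge>1. \<exists>c. c \<in> language u \<rightarrow> {1..r} \<and>
    (\<exists>k1. \<forall>k\<ge>k1. \<forall>w\<in>language u. \<not> uniform_monochromatic_power u c k w)"
proof -
  obtain \<alpha> w where \<alpha>: "\<zeta> \<alpha> = \<alpha> # w"
    using assms(2) by blast
  obtain \<beta> where "\<beta> \<noteq> \<alpha>"
    using assms(1) by (metis (full_types) card_2_iff)
  moreover have "primitive \<zeta>"
    using assms(5) by (simp add: admissible_def)
  ultimately have L: "L \<ge> 2"
    using primitive_length_ge_2 assms(3) \<alpha> by metis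
  \<comment> \<open>Strong recognizability provides some index, so the least one recognizes as
    well.\<close>
  have rec: "recognizes \<zeta> u K"
    using assms(5) unfolding assms(6) recognizability_index_def admissible_def
      strongly_recognizable_def by (auto intro: LeastI_ex)
  have image: "infinite_image \<zeta> u u"
    using assms(4) by (simp add: fixed_point_def)
  interpret recognizable_fixed_point \<zeta> u L K
  proof
    show "length (\<zeta> x) = L" for x
      using assms(3) by (simp add: constant_length_def)
    show "\<exists>p'. a = p' * L \<and> (\<forall>t<m. u (p + t) = u (p' + t))"
      if "m * L > K" "\<And>t. t < m * L \<Longrightarrow> u (p * L + t) = u (a + t)" for m p a
      using recognizes_constant_length[OF rec assms(3)] L that by simp
  qed (use assms(1) L infinite_image_nth[OF image assms(3)] in simp_all)
  show ?thesis
    by (rule ex_colouring)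
qed

end
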